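(* Let $k\ge 4$ be an integer and let $\gamma(t)=\exp(2\pi i t)+\exp(2\pi i (k+1)t)$. If $t,t'\in[0,1]$ with $t\ne t'$ satisfy $\gamma(t)=\gamma(t')$ and $\gamma(t)\neq 0$, then there exist integers $j,j'$ with $0\le j,j'\le k(k+2)$ such that $$t=\frac{j}{k(k+2)}\quad\text{and}\quad t'=\frac{j'}{k(k+2)}.$$ *)

theory Defs
  imports Complex_Main
begin

definition \<gamma> :: "int \<Rightarrow> real \<Rightarrow> complex" where
  "\<gamma> k t = exp (2 * of_real pi * \<i> * of_real t) + exp (2 * of_real pi * \<i> * of_int (k + 1) * of_real t)"

end

theory Submission
  imports Defs "HOL-Analysis.Complex_Transcendental"
begin

text \<open>
  Write \<open>e(x) = exp(2\<pi>ix)\<close>, so that \<open>\<gamma>(t) = e(t)(1 + e(kt))\<close>, and let \<open>z = e(kt)\<close> and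
  \<open>w = e(kt')\<close>. Taking absolute values in \<open>\<gamma>(t) = \<gamma>(t')\<close> gives \<open>|1 + z| = |1 + w|\<close> for
  points of the unit circle, hence \<open>w = z\<close> or \<open>w = 1/z\<close>. In the first case \<open>e(t) = e(t')\<close>, so
  \<open>t\<close> and \<open>t'\<close> are the endpoints of the interval. In the second case
  \<open>1 + w = (1 + z)/z\<close>, and cancelling \<open>1 + z\<close> shows that \<open>t - (k+1)t'\<close> and \<open>k(t + t')\<close>
  are integers; eliminating \<open>t\<close> makes \<open>k(k+2)t'\<close> an integer, and then also \<open>k(k+2)t\<close>.
\<close>

lemma cis_2pi_eq_iff: "cis (2 * pi * x) = cis (2 * pi * y) \<longleftrightarrow> x - y \<in> \<int>"
proof -
  have "cis (2 * pi * x) = cis (2 * pi * y) \<longleftrightarrow>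
      (\<exists>n::int. \<i> * of_real (2 * pi * x) = \<i> * of_real (2 * pi * y) + of_int (2 * n) * pi * \<i>)"
    unfolding cis_conv_exp exp_eq ..
  also have "\<dots> \<longleftrightarrow> (\<exists>n::int. 2 * pi * x = 2 * pi * y + of_int (2 * n) * pi)"
    by (simp add: complex_eq_iff)
  also have "\<dots> \<longleftrightarrow> (\<exists>n::int. x - y = of_int n)"
  proof (intro ex_cong1)
    fix n :: int
    have "2 * pi * x = 2 * pi * y + of_int (2 * n) * pi \<longleftrightarrow> 2 * pi * (x - y) = 2 * pi * of_int n"
      by (simp add: algebra_simps)
    then show "2 * pi * x = 2 * pi * y + of_int (2 * n) * pi \<longleftrightarrow> x - y = of_int n"
      by simp
  qed
  finally show ?thesis
    by (auto simp: Ints_def)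
qed

text \<open>On the unit circle the squared norm of \<open>1 + z\<close> is
  \<open>2 + 2 * Re z\<close>, so equal norms force equal real parts. The imaginary parts then agree
  up to sign, and the conjugate of \<open>z\<close> is its inverse.\<close>

lemma unit_circle_norm_one_plus_eq:
  fixes z w :: complex
  assumes "norm z = 1" "norm w = 1" "norm (1 + z) = norm (1 + w)"
  shows "w = z \<or> z * w = 1"
proof -
  have z: "(Re z)\<^sup>2 + (Im z)\<^sup>2 = 1" and w: "(Re w)\<^sup>2 + (Im w)\<^sup>2 = 1"
    using assms(1,2) by (simp_all add: cmod_def)
  have "(1 + Re z)\<^sup>2 + (Im z)\<^sup>2 = (1 + Re w)\<^sup>2 + (Im w)\<^sup>2"
    using assms(3) by (simp add: cmod_def)
  with z w have re: "Re w = Re z"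
    by (simp add: power2_sum)
  with z w have "(Im w)\<^sup>2 = (Im z)\<^sup>2"
    by simp
  then consider "Im w = Im z" | "Im w = - Im z"
    by (auto simp: power2_eq_iff)
  then show ?thesis
    by cases (use re z in \<open>auto simp: complex_eq_iff power2_eq_square\<close>)
qed

lemma \<gamma>_conv_cis: "\<gamma> k t = cis (2 * pi * t) * (1 + cis (2 * pi * (k * t)))"
  unfolding \<gamma>_def cis_conv_exp by (simp add: exp_add[symmetric] algebra_simps)

lemma unit_interval_eq_fraction:
  fixes x :: real and n :: int
  assumes "x \<in> {0..1}" "n > 0" "of_int n * x \<in> \<int>"
  obtains j :: int where "0 \<le> j" "j \<le> n" "x = of_int j / of_int n"
proof -
  from assms(3) obtain j :: int where j: "of_int n * x = of_int j"
    by (auto elim: Ints_cases)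
  have "0 \<le> of_int n * x" "of_int n * x \<le> of_int n"
    using assms(1,2) by (simp_all add: mult_left_le)
  then have "0 \<le> j" "j \<le> n"
    unfolding j by simp_all
  moreover have "x = of_int j / of_int n"
    using j assms(2) by (simp add: field_simps)
  ultimately show thesis
    by (rule that)
qed

text \<open>Treating \<open>t'\<close> alone suffices: the hypotheses are symmetric in
  \<open>t\<close> and \<open>t'\<close>, so exchanging the two gives the claim for
  \<open>t\<close>.\<close>

lemma double_point_Ints:
  fixes k :: int and t t' :: real
  assumes "t \<in> {0..1}" "t' \<in> {0..1}" "\<gamma> k t = \<gamma> k t'" "\<gamma> k t \<noteq> 0" "t \<noteq> t'"
  shows "of_int (k * (k + 2)) * t' \<in> \<int>"
proof -
  define z where "z = cis (2 * pi * (k * t))"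
  define w where "w = cis (2 * pi * (k * t'))"
  have eq: "cis (2 * pi * t) * (1 + z) = cis (2 * pi * t') * (1 + w)" and nz: "1 + z \<noteq> 0"
    using assms(3,4) by (auto simp: \<gamma>_conv_cis z_def w_def)
  have "norm (1 + z) = norm (1 + w)"
    using arg_cong[OF eq, of norm] by (simp add: norm_mult)
  then consider "w = z" | "z * w = 1"
    using unit_circle_norm_one_plus_eq[of z w] by (auto simp: z_def w_def)
  then show ?thesis
  proof cases
    case 1
    with eq nz have "t - t' \<in> \<int>"
      by (simp add: cis_2pi_eq_iff)
    then obtain n :: int where n: "t - t' = of_int n"
      by (auto elim: Ints_cases)
    with assms(1,2,5) have "n \<noteq> 0" "-1 \<le> real_of_int n" "real_of_int n \<le> 1"
      by auto
    then have "n = 1 \<or> n = -1"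
      by linarith
    \<comment> \<open>Two points of the unit interval at distance 1 are its endpoints.\<close>
    with n assms(1,2) have "t' = 0 \<or> t' = 1"
      by auto
    then show ?thesis
      by auto
  next
    case 2
    \<comment> \<open>Since \<open>z * w = 1\<close>, \<open>1 + w = w * (1 + z)\<close>; this
      exposes the nonzero factor \<open>1 + z\<close> on both sides of \<open>eq\<close>.\<close>
    have "cis (2 * pi * t') * (1 + w) = cis (2 * pi * t') * w * (1 + z)"
      using 2 by (simp add: algebra_simps)
    with eq nz have "cis (2 * pi * t) = cis (2 * pi * t') * w"
      by simp
    also have "\<dots> = cis (2 * pi * ((k + 1) * t'))"
      by (simp add: w_def cis_mult algebra_simps)
    finally have n: "t - (k + 1) * t' \<in> \<int>"
      by (simp only: cis_2pi_eq_iff)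
    have "cis (2 * pi * (k * (t + t'))) = cis (2 * pi * 0)"
      using 2 by (simp add: z_def w_def cis_mult algebra_simps)
    then have m: "k * (t + t') \<in> \<int>"
      by (simp only: cis_2pi_eq_iff) simp
    \<comment> \<open>This combination eliminates \<open>t\<close>; the remaining coefficient of
      \<open>t'\<close> is \<open>k + k * (k + 1)\<close>.\<close>
    have "of_int (k * (k + 2)) * t' = k * (t + t') - k * (t - (k + 1) * t')"
      by (simp add: algebra_simps)
    also have "\<dots> \<in> \<int>"
      by (rule Ints_diff[OF m Ints_mult[OF Ints_of_int n]])
    finally show ?thesis .
  qed
qed

theorem theorem2:
  fixes k :: int and t t' :: real
  assumes "k \<ge> 4"
    and "t \<in> {0..1}" and "t' \<in> {0..1}" and "t \<noteq> t'"
    and "\<gamma> k t = \<gamma> k t'" and "\<gamma> k t \<noteq> 0"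
  shows "\<exists>j j' :: int. 0 \<le> j \<and> j \<le> k * (k + 2) \<and> 0 \<le> j' \<and> j' \<le> k * (k + 2) \<and>
           t = of_int j / of_int (k * (k + 2)) \<and> t' = of_int j' / of_int (k * (k + 2))"
proof -
  have pos: "k * (k + 2) > 0"
    using assms(1) by simp
  have "of_int (k * (k + 2)) * t \<in> \<int>" "of_int (k * (k + 2)) * t' \<in> \<int>"
    using double_point_Ints[of t' t k] double_point_Ints[of t t' k] assms by auto
  then show ?thesis
    using unit_interval_eq_fraction[OF assms(2) pos] unit_interval_eq_fraction[OF assms(3) pos]
    by metis
qed

end
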